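(* Let $Z^*_{\mathsf{P}}$ and $Z^*_{\mathsf{RA}}$ denote the optimal objective values of the continuous relaxations of formulations $\mathsf{P}$ and $\mathsf{RA}$ (given in the context), respectively. Then $Z^*_{\mathsf{P}}\le Z^*_{\mathsf{RA}}$.
   Context: Notation: $[N]=\{1,\dots,N\}$. Data: positive integers $n,K$; weights $\lambda_k\ge 0$ with $\sum_{k=1}^K\lambda_k=1$; real numbers $\beta_{k,i}$ for $k\in[K]$, $i\in\{0,1,\dots,n\}$; a matrix $\mathbf{C}\in\mathbb{R}^{m\times n}$ and a vector $\mathbf{d}\in\mathbb{R}^m$, which define the feasible set $\mathcal{A}=\{\mathbf{a}\in\{0,1\}^n:\mathbf{C}\mathbf{a}\le\mathbf{d}\}$. Conventions: $0\log 0=0$, and an expression of the form $x e^{-w/x}$ is taken to be $0$ when $x=0$. Formulation $\mathsf{RA}$ (real decision variables $a_i$, $u_k$, $w_k$, $x_{k,0},x_{k,1}$, $y_{k,i}$ for $k\in[K]$, $i\in[n]$): maximize $\sum_{k=1}^K\lambda_k x_{k,1}$ subject to - $x_{k,1}+x_{k,0}=1$ for all $k\in[K]$; - $w_k-x_{k,1}\log(x_{k,1})-x_{k,0}\log(x_{k,0})\ge\log(1+\exp(u_k))$ for all $k\in[K]$; - $u_k=\beta_{k,0}+\sum_{i=1}^n\beta_{k,i}a_i$ for all $k\in[K]$; - $w_k=\beta_{k,0}x_{k,1}+\sum_{i=1}^n\beta_{k,i}y_{k,i}$ for all $k\in[K]$; - $y_{k,i}\le x_{k,1}$, $y_{k,i}\le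 a_i$, $y_{k,i}\ge a_i-1+x_{k,1}$, $y_{k,i}\ge 0$ for all $k\in[K]$, $i\in[n]$; - $\mathbf{C}\mathbf{a}\le\mathbf{d}$; $a_i\in\{0,1\}$ for all $i\in[n]$; $x_{k,1},x_{k,0}\ge 0$ for all $k\in[K]$. Formulation $\mathsf{P}$ (real decision variables $a_i$, $w_k$, $x_{k,0},x_{k,1}$, $y_{k,i}$ for $k\in[K]$, $i\in[n]$): maximize $\sum_{k=1}^K\lambda_k x_{k,1}$ subject to - $x_{k,1}+x_{k,1}e^{-w_k/x_{k,1}}\le 1$ for all $k\in[K]$; - $w_k=\beta_{k,0}x_{k,1}+\sum_{i=1}^n\beta_{k,i}y_{k,i}$ for all $k\in[K]$; - $y_{k,i}\le a_i$, $y_{k,i}\le x_{k,1}$, $y_{k,i}\ge x_{k,1}+a_i-1$, $y_{k,i}\ge 0$ for all $k\in[K]$, $i\in[n]$; - $x_{k,0},x_{k,1}\ge 0$ for all $k\in[K]$; - $\mathbf{C}\mathbf{a}\le\mathbf{d}$; $\mathbf{a}\in\{0,1\}^n$. The continuous relaxation of either formulation is the problem obtained by replacing $\mathbf{a}\in\{0,1\}^n$ with $0\le a_i\le 1$ for all $i\in[n]$. *)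

theory Defs
  imports "HOL-Analysis.Analysis"
begin

text \<open>
  Indices are natural numbers: \<open>i\<close> runs over \<open>{1..n}\<close>, \<open>k\<close> over \<open>{1..K}\<close>, and the rows of \<open>C\<close>
  and \<open>d\<close> over \<open>{1..m}\<close> (with \<open>m = 0\<close> allowed). Values of vectors outside these ranges play no role.
  The intercept of class \<open>k\<close> is \<open>\<beta> k 0\<close>; the variables \<open>x\<^sub>k\<^sub>,\<^sub>0\<close>, \<open>x\<^sub>k\<^sub>,\<^sub>1\<close> are \<open>x k 0\<close>, \<open>x k 1\<close>.
\<close>

definition xlogx :: "real \<Rightarrow> real" where
  "xlogx x = (if x = 0 then 0 else x * ln x)"

definition xexp :: "real \<Rightarrow> real \<Rightarrow> real" where
  "xexp x w = (if x = 0 then 0 else x * exp (- w / x))"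

definition lin_constr ::
  "nat \<Rightarrow> nat \<Rightarrow> (nat \<Rightarrow> nat \<Rightarrow> real) \<Rightarrow> (nat \<Rightarrow> real) \<Rightarrow> (nat \<Rightarrow> real) \<Rightarrow> bool" where
  "lin_constr n m C d a \<longleftrightarrow> (\<forall>j\<in>{1..m}. (\<Sum>i=1..n. C j i * a i) \<le> d j)"

text \<open>
  In both formulations \<open>D\<close> is the set in which each \<open>a i\<close> must lie: \<open>{0, 1}\<close> gives the
  formulation itself and \<open>{0..1}\<close> its continuous relaxation.
\<close>

definition RA_feasible ::
  "nat \<Rightarrow> nat \<Rightarrow> nat \<Rightarrow> (nat \<Rightarrow> nat \<Rightarrow> real) \<Rightarrow> (nat \<Rightarrow> nat \<Rightarrow> real) \<Rightarrow> (nat \<Rightarrow> real) \<Rightarrow> real set \<Rightarrow>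
   (nat \<Rightarrow> real) \<Rightarrow> (nat \<Rightarrow> real) \<Rightarrow> (nat \<Rightarrow> real) \<Rightarrow> (nat \<Rightarrow> nat \<Rightarrow> real) \<Rightarrow> (nat \<Rightarrow> nat \<Rightarrow> real) \<Rightarrow> bool"
where
  "RA_feasible n K m \<beta> C d D a u w x y \<longleftrightarrow>
     (\<forall>k\<in>{1..K}. x k 1 + x k 0 = 1) \<and>
     (\<forall>k\<in>{1..K}. w k - xlogx (x k 1) - xlogx (x k 0) \<ge> ln (1 + exp (u k))) \<and>
     (\<forall>k\<in>{1..K}. u k = \<beta> k 0 + (\<Sum>i=1..n. \<beta> k i * a i)) \<and>
     (\<forall>k\<in>{1..K}. w k = \<beta> k 0 * x k 1 + (\<Sum>i=1..n. \<beta> k i * y k i)) \<and>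
     (\<forall>k\<in>{1..K}. \<forall>i\<in>{1..n}.
        y k i \<le> x k 1 \<and> y k i \<le> a i \<and> y k i \<ge> a i - 1 + x k 1 \<and> y k i \<ge> 0) \<and>
     lin_constr n m C d a \<and>
     (\<forall>i\<in>{1..n}. a i \<in> D) \<and>
     (\<forall>k\<in>{1..K}. x k 1 \<ge> 0 \<and> x k 0 \<ge> 0)"

definition P_feasible ::
  "nat \<Rightarrow> nat \<Rightarrow> nat \<Rightarrow> (nat \<Rightarrow> nat \<Rightarrow> real) \<Rightarrow> (nat \<Rightarrow> nat \<Rightarrow> real) \<Rightarrow> (nat \<Rightarrow> real) \<Rightarrow> real set \<Rightarrow>
   (nat \<Rightarrow> real) \<Rightarrow> (nat \<Rightarrow> real) \<Rightarrow> (nat \<Rightarrow> nat \<Rightarrow> real) \<Rightarrow> (nat \<Rightarrow> nat \<Rightarrow> real) \<Rightarrow> bool"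
where
  "P_feasible n K m \<beta> C d D a w x y \<longleftrightarrow>
     (\<forall>k\<in>{1..K}. x k 1 + xexp (x k 1) (w k) \<le> 1) \<and>
     (\<forall>k\<in>{1..K}. w k = \<beta> k 0 * x k 1 + (\<Sum>i=1..n. \<beta> k i * y k i)) \<and>
     (\<forall>k\<in>{1..K}. \<forall>i\<in>{1..n}.
        y k i \<le> a i \<and> y k i \<le> x k 1 \<and> y k i \<ge> x k 1 + a i - 1 \<and> y k i \<ge> 0) \<and>
     (\<forall>k\<in>{1..K}. x k 0 \<ge> 0 \<and> x k 1 \<ge> 0) \<and>
     lin_constr n m C d a \<and>
     (\<forall>i\<in>{1..n}. a i \<in> D)"

definition objective :: "nat \<Rightarrow> (nat \<Rightarrow> real) \<Rightarrow> (nat \<Rightarrow> nat \<Rightarrow> real) \<Rightarrow> real" where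
  "objective K lam x = (\<Sum>k=1..K. lam k * x k 1)"

text \<open>
  Optimal values are suprema in the extended reals, so an infeasible problem has value \<open>- \<infinity>\<close>.
\<close>

definition RA_value ::
  "nat \<Rightarrow> nat \<Rightarrow> nat \<Rightarrow> (nat \<Rightarrow> real) \<Rightarrow> (nat \<Rightarrow> nat \<Rightarrow> real) \<Rightarrow> (nat \<Rightarrow> nat \<Rightarrow> real) \<Rightarrow> (nat \<Rightarrow> real) \<Rightarrow>
   real set \<Rightarrow> ereal" where
  "RA_value n K m lam \<beta> C d D =
     Sup {ereal (objective K lam x) | a u w x y. RA_feasible n K m \<beta> C d D a u w x y}"

definition P_value ::
  "nat \<Rightarrow> nat \<Rightarrow> nat \<Rightarrow> (nat \<Rightarrow> real) \<Rightarrow> (nat \<Rightarrow> nat \<Rightarrow> real) \<Rightarrow> (nat \<Rightarrow> nat \<Rightarrow> real) \<Rightarrow> (nat \<Rightarrow> real) \<Rightarrow>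
   real set \<Rightarrow> ereal" where
  "P_value n K m lam \<beta> C d D =
     Sup {ereal (objective K lam x) | a w x y. P_feasible n K m \<beta> C d D a w x y}"

definition Z_RA ::
  "nat \<Rightarrow> nat \<Rightarrow> nat \<Rightarrow> (nat \<Rightarrow> real) \<Rightarrow> (nat \<Rightarrow> nat \<Rightarrow> real) \<Rightarrow> (nat \<Rightarrow> nat \<Rightarrow> real) \<Rightarrow> (nat \<Rightarrow> real) \<Rightarrow>
   ereal" where
  "Z_RA n K m lam \<beta> C d = RA_value n K m lam \<beta> C d {0..1}"

definition Z_P ::
  "nat \<Rightarrow> nat \<Rightarrow> nat \<Rightarrow> (nat \<Rightarrow> real) \<Rightarrow> (nat \<Rightarrow> nat \<Rightarrow> real) \<Rightarrow> (nat \<Rightarrow> nat \<Rightarrow> real) \<Rightarrow> (nat \<Rightarrow> real) \<Rightarrow>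
   ereal" where
  "Z_P n K m lam \<beta> C d = P_value n K m lam \<beta> C d {0..1}"

end

theory Submission
  imports Defs
begin

text \<open>
  The relaxed vector \<open>a\<close> is kept and the classes are treated separately, so fix one class and drop
  its index, writing \<open>x\<close> for \<open>x\<^sub>k\<^sub>,\<^sub>1\<close>. Let \<open>p\<close> be the logistic function of the utility \<open>u\<close>. If \<open>x \<le> p\<close>,
  then \<open>x\<close> can be raised to \<open>p\<close> with \<open>y = p a\<close>, for which the entropy constraint of \<open>RA\<close> is an
  equality. Otherwise \<open>0 < x < 1\<close> and the constraint of \<open>P\<close> says \<open>w \<ge> x ln (x / (1 - x))\<close>; hence
  \<open>w\<close> plus the entropy of \<open>x\<close> is at least \<open>- ln (1 - x) = ln (1 + x / (1 - x))\<close>, and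
  \<open>x / (1 - x) > exp u\<close> because \<open>x > p\<close>. So \<open>(x, y)\<close> itself is feasible for \<open>RA\<close>.
\<close>

text \<open>Fenchel equality: ln (1 + exp u) is the convex conjugate of the negative binary entropy,
  and \<open>p\<close>, its derivative at \<open>u\<close>, attains the maximum.\<close>

lemma entropy_logistic:
  fixes u :: real
  defines "p \<equiv> exp u / (1 + exp u)"
  shows "p * u - xlogx p - xlogx (1 - p) = ln (1 + exp u)"
proof -
  have pos: "1 + exp u > 0" by (simp add: add_pos_pos)
  have q: "1 - p = 1 / (1 + exp u)" using pos by (simp add: p_def field_simps)
  have "p \<noteq> 0" and "1 - p \<noteq> 0" using pos unfolding q by (simp_all add: p_def)
  moreover have "ln p = u - ln (1 + exp u)" and "ln (1 - p) = - ln (1 + exp u)"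
    using pos unfolding q by (simp_all add: p_def ln_div)
  ultimately have "p * u - xlogx p - xlogx (1 - p)
      = p * u - p * (u - ln (1 + exp u)) - (1 - p) * (- ln (1 + exp u))"
    by (simp only: xlogx_def if_False)
  thus ?thesis by (simp add: algebra_simps)
qed

lemma perspective_constraint_imp_entropy:
  assumes "x > 0" "x + xexp x w \<le> 1" "exp u / (1 + exp u) \<le> x"
  shows "x < 1" and "w - xlogx x - xlogx (1 - x) \<ge> ln (1 + exp u)"
proof -
  have e: "x + x * exp (- w / x) \<le> 1" using assms by (simp add: xexp_def)
  moreover have "x * exp (- w / x) > 0" using assms by simp
  ultimately show x1: "x < 1" by linarith
  have "exp (- w / x) \<le> (1 - x) / x" using e assms(1) by (simp add: field_simps)
  hence "- w / x \<le> ln ((1 - x) / x)"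
    using ln_ge_iff[of "(1 - x) / x"] assms(1) x1 by simp
  hence w: "x * (ln x - ln (1 - x)) \<le> w"
    using assms(1) x1 by (simp add: ln_div field_simps)
  have "1 + exp u > 0" by (simp add: add_pos_pos)
  \<comment> \<open>In terms of odds, the bound on \<open>x\<close> says exp u \<le> x / (1 - x);
    adding 1 gives 1 / (1 - x) on the right.\<close>
  hence "1 + exp u \<le> 1 / (1 - x)"
    using assms(3) x1 by (simp add: field_simps)
  hence "ln (1 + exp u) \<le> ln (1 / (1 - x))"
    using \<open>1 + exp u > 0\<close> x1 by (subst ln_le_cancel_iff) auto
  hence "ln (1 + exp u) \<le> - ln (1 - x)" using x1 by (simp add: ln_div)
  thus "w - xlogx x - xlogx (1 - x) \<ge> ln (1 + exp u)"
    using w assms(1) x1 by (simp add: xlogx_def algebra_simps)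
qed

lemma class_P_to_RA:
  fixes a y b :: "nat \<Rightarrow> real" and b0 x :: real
  assumes a: "\<And>i. i \<in> I \<Longrightarrow> 0 \<le> a i \<and> a i \<le> 1"
    and y: "\<And>i. i \<in> I \<Longrightarrow> y i \<le> a i \<and> y i \<le> x \<and> y i \<ge> x + a i - 1 \<and> y i \<ge> 0"
    and P: "x + xexp x (b0 * x + (\<Sum>i\<in>I. b i * y i)) \<le> 1"
  shows "\<exists>p z. x \<le> p \<and> 0 \<le> p \<and> p \<le> 1 \<and>
    (\<forall>i\<in>I. z i \<le> p \<and> z i \<le> a i \<and> z i \<ge> a i - 1 + p \<and> z i \<ge> 0) \<and>
    b0 * p + (\<Sum>i\<in>I. b i * z i) - xlogx p - xlogx (1 - p)
      \<ge> ln (1 + exp (b0 + (\<Sum>i\<in>I. b i * a i)))"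
proof -
  define u where "u = b0 + (\<Sum>i\<in>I. b i * a i)"
  define p where "p = exp u / (1 + exp u)"
  have "1 + exp u > 0" by (simp add: add_pos_pos)
  hence p: "0 < p" "p < 1" by (simp_all add: p_def)
  show ?thesis
  proof (cases "x \<le> p")
    \<comment> \<open>Since \<open>p > 0\<close>, this case absorbs \<open>x = 0\<close>, so the
      other case never meets the convention for \<open>xexp\<close> at 0.\<close>
    case True
    have "p * a i \<le> p \<and> p * a i \<le> a i \<and> p * a i \<ge> a i - 1 + p \<and> p * a i \<ge> 0"
      if "i \<in> I" for i
    proof -
      \<comment> \<open>Expanding these products of distances to the bounds 0 and 1 gives the four
        McCormick inequalities for the exact product.\<close>
      have "(1 - a i) * (1 - p) \<ge> 0" "p * (1 - a i) \<ge> 0" "(1 - p) * a i \<ge> 0" "p * a i \<ge> 0"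
        using a[OF that] p by simp_all
      thus ?thesis by (simp add: algebra_simps)
    qed
    moreover have "b0 * p + (\<Sum>i\<in>I. b i * (p * a i)) = p * u"
      by (simp add: u_def algebra_simps sum_distrib_left)
    ultimately show ?thesis
      using True p entropy_logistic[of u]
      by (intro exI[of _ p] exI[of _ "\<lambda>i. p * a i"]) (simp add: p_def u_def)
  next
    case False
    hence "x > 0" "exp u / (1 + exp u) \<le> x" using p by (simp_all add: p_def)
    from perspective_constraint_imp_entropy[OF this(1) P this(2)] show ?thesis
      using \<open>x > 0\<close> y
      by (intro exI[of _ x] exI[of _ y]) (auto simp: u_def algebra_simps)
  qed
qed

lemma P_feasible_imp_RA_feasible:
  assumes "P_feasible n K m \<beta> C d {0..1} a w x y"
  shows "\<exists>u w' x' y'. RA_feasible n K m \<beta> C d {0..1} a u w' x' y' \<and>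
    (\<forall>k\<in>{1..K}. x k 1 \<le> x' k 1)"
proof -
  \<comment> \<open>Naming the condition for one class lets \<open>p\<close> and \<open>z\<close> be
    chosen as functions of \<open>k\<close>.\<close>
  define Q where "Q k p z \<longleftrightarrow> x k 1 \<le> p \<and> 0 \<le> p \<and> p \<le> 1 \<and>
    (\<forall>i\<in>{1..n}. z i \<le> p \<and> z i \<le> a i \<and> z i \<ge> a i - 1 + p \<and> z i \<ge> 0) \<and>
    \<beta> k 0 * p + (\<Sum>i=1..n. \<beta> k i * z i) - xlogx p - xlogx (1 - p)
      \<ge> ln (1 + exp (\<beta> k 0 + (\<Sum>i=1..n. \<beta> k i * a i)))" for k p and z :: "nat \<Rightarrow> real"
  have "\<exists>p z. Q k p z" if k: "k \<in> {1..K}" for k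
    unfolding Q_def
  proof (rule class_P_to_RA)
    have "x k 1 + xexp (x k 1) (w k) \<le> 1"
      and "w k = \<beta> k 0 * x k 1 + (\<Sum>i=1..n. \<beta> k i * y k i)"
      using assms k unfolding P_feasible_def by blast+
    thus "x k 1 + xexp (x k 1) (\<beta> k 0 * x k 1 + (\<Sum>i=1..n. \<beta> k i * y k i)) \<le> 1"
      by simp
  qed (use assms k in \<open>auto simp: P_feasible_def\<close>)
  then obtain p z where "\<And>k. k \<in> {1..K} \<Longrightarrow> Q k (p k) (z k)"
    by metis
  note pz = this[unfolded Q_def]
  \<comment> \<open>\<open>P\<close> does not tie \<open>x k 0\<close> to \<open>x k 1\<close>, so
    the old \<open>x k 0\<close> is discarded and replaced by the complement that \<open>RA\<close>
    demands.\<close>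
  define x' where "x' = (\<lambda>k j :: nat. if j = 1 then p k else 1 - p k)"
  have "RA_feasible n K m \<beta> C d {0..1} a (\<lambda>k. \<beta> k 0 + (\<Sum>i=1..n. \<beta> k i * a i))
    (\<lambda>k. \<beta> k 0 * x' k 1 + (\<Sum>i=1..n. \<beta> k i * z k i)) x' z"
    unfolding RA_feasible_def using assms pz by (simp add: x'_def P_feasible_def)
  moreover have "\<forall>k\<in>{1..K}. x k 1 \<le> x' k 1" using pz by (simp add: x'_def)
  ultimately show ?thesis by blast
qed

theorem proposition2:
  fixes n K m :: nat
    and lam :: "nat \<Rightarrow> real"
    and \<beta> :: "nat \<Rightarrow> nat \<Rightarrow> real"
    and C :: "nat \<Rightarrow> nat \<Rightarrow> real"
    and d :: "nat \<Rightarrow> real"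
  assumes "n \<ge> 1" and "K \<ge> 1"
    and "\<And>k. k \<in> {1..K} \<Longrightarrow> lam k \<ge> 0"
    and "(\<Sum>k=1..K. lam k) = 1"
  shows "Z_P n K m lam \<beta> C d \<le> Z_RA n K m lam \<beta> C d"
  unfolding Z_P_def Z_RA_def P_value_def RA_value_def
\<comment> \<open>Dominating each feasible value bounds the suprema, attained or not, and covers an
  infeasible relaxation of \<open>P\<close>.\<close>
proof (rule Sup_mono)
  fix v
  assume "v \<in> {ereal (objective K lam x) | a w x y. P_feasible n K m \<beta> C d {0..1} a w x y}"
  then obtain a w x y where v: "v = ereal (objective K lam x)"
    and "P_feasible n K m \<beta> C d {0..1} a w x y" by blast
  from P_feasible_imp_RA_feasible[OF this(2)] obtain u w' x' y'
    where RA: "RA_feasible n K m \<beta> C d {0..1} a u w' x' y'"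
      and le: "\<forall>k\<in>{1..K}. x k 1 \<le> x' k 1" by blast
  have "v \<le> ereal (objective K lam x')"
    unfolding v objective_def using le assms(3)
    by (auto intro!: sum_mono mult_left_mono)
  with RA show "\<exists>b\<in>{ereal (objective K lam x) | a u w x y.
      RA_feasible n K m \<beta> C d {0..1} a u w x y}. v \<le> b"
    by blast
qed

end
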